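(* Let $G$ be a graph. For every vertex $v$ of $G$, suppose that we have chosen three integers $a_v^1,a_v^2,a_v^3$ such that $\frac{3}{10}d_G(v)\le a_v^1\le \frac{4}{10}d_G(v)\le a_v^2\le \frac{6}{10}d_G(v)\le a_v^3\le \frac{7}{10}d_G(v)$. Let $L(v)=\{a_v^1,\,a_v^1+1,\,a_v^2,\,a_v^2+1,\,a_v^3,\,a_v^3+1\}$ for every $v\in V(G)$. Then $G$ contains an $L$-factor.
   Context: All graphs are finite, undirected and simple; $d_G(v)$ denotes the degree of $v$ in $G$. Let $L:V(G)\to 2^{\mathbb N}$ be a function assigning to each vertex a set of nonnegative integers. An $L$-factor of $G$ is a spanning subgraph $H$ of $G$ such that $d_H(v)\in L(v)$ for all $v\in V(G)$. *)

theory Defs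
  imports Complex_Main
begin

text \<open>A graph is a pair of a vertex set and a set of edges, each edge being the set of its two ends.\<close>

type_synonym 'a graph = "'a set \<times> 'a set set"

abbreviation verts :: "'a graph \<Rightarrow> 'a set" where
  "verts G \<equiv> fst G"

abbreviation edges :: "'a graph \<Rightarrow> 'a set set" where
  "edges G \<equiv> snd G"

definition finite_simple_graph :: "'a graph \<Rightarrow> bool" where
  "finite_simple_graph G \<longleftrightarrow>
     finite (verts G) \<and> (\<forall>e\<in>edges G. e \<subseteq> verts G \<and> card e = 2)"

definition degree :: "'a graph \<Rightarrow> 'a \<Rightarrow> nat" where
  "degree G v = card {e \<in> edges G. v \<in> e}"

definition spanning_subgraph :: "'a graph \<Rightarrow> 'a graph \<Rightarrow> bool" where
  "spanning_subgraph H G \<longleftrightarrow>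
     finite_simple_graph H \<and> verts H = verts G \<and> edges H \<subseteq> edges G"

definition is_factor :: "('a \<Rightarrow> nat set) \<Rightarrow> 'a graph \<Rightarrow> 'a graph \<Rightarrow> bool" where
  "is_factor L H G \<longleftrightarrow>
     spanning_subgraph H G \<and> (\<forall>v\<in>verts G. degree H v \<in> L v)"

end

theory Submission
  imports Defs
begin

text \<open>
  Call \<open>C v\<close> the set of admissible lower values \<open>a\<close> at \<open>v\<close>; the aim is a set of edges \<open>h\<close> in which
  every vertex has degree \<open>a\<close> or \<open>a + 1\<close> for some \<open>a \<in> C v\<close>. Here \<open>C v\<close> consists of the three given
  integers, but all that matters is how far apart they are: from a value more than one below half the degree
  \<open>d\<close> of \<open>v\<close> one can go up to a value at most about twice as large, and from a value \<open>a\<close> above \<open>d / 2\<close>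
  one can go down to some \<open>b\<close> for which the complementary value \<open>d - b\<close> is at most about twice
  \<open>d - a\<close>. The result for such sets \<open>C v\<close> is \<open>paired_degree_subgraph\<close>.

  Choose values \<open>a v \<in> C v\<close> and a set of edges \<open>h\<close>, with all degrees in \<open>h\<close> at most \<open>a v + 1\<close>, so that
  the total deficiency \<open>\<Sum>v. max 0 (a v - deg h v)\<close> is least. If it is positive, follow alternating
  paths from the deficient vertices, beginning with an edge outside \<open>h\<close>. Exchanging the edges of such
  a path gives the first vertex one more edge, so minimality prevents the path from ending where its
  last vertex can absorb the change: vertices entered through an edge outside \<open>h\<close> are full (degree \<open>a v + 1\<close>), those entered
  through an edge of \<open>h\<close> are not. Let \<open>A\<close> be the set of full and \<open>B\<close> the set of non-full vertices
  that are reached. All edges of \<open>h\<close> at \<open>A\<close> go to \<open>B\<close> (\<open>edge_of_A\<close>), and all edges outside \<open>h\<close> at \<open>B\<close>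
  go to \<open>A\<close> (\<open>nonedge_of_B\<close>).

  If \<open>h\<close> had at least half of the edges at every vertex of \<open>A\<close>, at most half at every vertex of \<open>B\<close>
  and less than half at deficient ones,
  counting the edges between \<open>A\<close> and \<open>B\<close> inside and outside \<open>h\<close> would be contradictory. A vertex that
  violates this could change its value \<open>a v\<close>: a full vertex with a small value can take many edges
  to \<open>B\<close>, whose vertices all have room for one more, and a non-full vertex with a large value can give
  up many edges to \<open>A\<close>, whose vertices can all spare one. Minimality excludes this as well, so there
  are few such edges; the bounds on the gaps in \<open>C v\<close> make them few enough
  (\<open>few_edges_to_A\<close>, \<open>few_nonedges_to_B\<close>) for the same double count to give a contradiction
  (\<open>no_deficient\<close>).
\<close>

section \<open>Degrees in sets of edges\<close>

definition deg :: "'a set set \<Rightarrow> 'a \<Rightarrow> nat" where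
  "deg h v = card {e \<in> h. v \<in> e}"

lemma deg_Un_disjoint:
  assumes "finite h" "finite k" "h \<inter> k = {}"
  shows "deg (h \<union> k) v = deg h v + deg k v"
proof -
  have "{e \<in> h \<union> k. v \<in> e} = {e \<in> h. v \<in> e} \<union> {e \<in> k. v \<in> e}" by auto
  then show ?thesis
    unfolding deg_def using assms by (simp add: card_Un_disjoint disjoint_iff)
qed

lemma deg_Diff_add:
  assumes "finite h" "k \<subseteq> h"
  shows "deg (h - k) v + deg k v = deg h v"
proof -
  have "(h - k) \<union> k = h" using assms by blast
  moreover have "(h - k) \<inter> k = {}" by blast
  moreover have "finite (h - k)" "finite k" using assms finite_subset by auto
  ultimately show ?thesis using deg_Un_disjoint[of "h - k" k v] by simp
qed

lemma deg_singleton: "deg {e} v = of_bool (v \<in> e)"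
proof -
  have "{x \<in> {e}. v \<in> x} = (if v \<in> e then {e} else {})" by auto
  then show ?thesis by (simp add: deg_def)
qed

lemma deg_star_centre:
  assumes "\<And>e. e \<in> k \<Longrightarrow> v \<in> e"
  shows "deg k v = card k"
proof -
  have "{e \<in> k. v \<in> e} = k" using assms by blast
  then show ?thesis by (simp add: deg_def)
qed

lemma card_two_eq:
  assumes "card e = 2" "u \<in> e" "v \<in> e" "u \<noteq> v"
  shows "e = {u, v}"
  using assms by (auto simp: card_2_iff)

text \<open>
  A set of edges through \<open>v\<close> is a star, so it changes the degree of every other vertex by at most one.
\<close>

lemma deg_star_leaf:
  assumes "\<And>e. e \<in> k \<Longrightarrow> v \<in> e \<and> card e = 2" "u \<noteq> v"
  shows "deg k u = of_bool ({u, v} \<in> k)"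
proof -
  have "{e \<in> k. u \<in> e} = (if {u, v} \<in> k then {{u, v}} else {})"
    using assms card_two_eq[of _ u v] by auto
  then show ?thesis by (simp add: deg_def)
qed

text \<open>
  An edge that meets both of two disjoint sets has exactly one end in each, so counting from the side
  of \<open>X\<close> counts each such edge once.
\<close>

lemma sum_card_edges_across:
  assumes "finite h" "\<And>e. e \<in> h \<Longrightarrow> card e = 2" "finite X" "X \<inter> Y = {}"
  shows "(\<Sum>v\<in>X. card {e \<in> h. v \<in> e \<and> e \<inter> Y \<noteq> {}}) = card {e \<in> h. e \<inter> X \<noteq> {} \<and> e \<inter> Y \<noteq> {}}"
proof -
  have "{e \<in> h. e \<inter> X \<noteq> {} \<and> e \<inter> Y \<noteq> {}} = (\<Union>v\<in>X. {e \<in> h. v \<in> e \<and> e \<inter> Y \<noteq> {}})"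
    by auto
  moreover have "card (\<Union>v\<in>X. {e \<in> h. v \<in> e \<and> e \<inter> Y \<noteq> {}})
      = (\<Sum>v\<in>X. card {e \<in> h. v \<in> e \<and> e \<inter> Y \<noteq> {}})"
  proof (rule card_UN_disjoint)
    show "\<forall>i\<in>X. \<forall>j\<in>X. i \<noteq> j \<longrightarrow>
        {e \<in> h. i \<in> e \<and> e \<inter> Y \<noteq> {}} \<inter> {e \<in> h. j \<in> e \<and> e \<inter> Y \<noteq> {}} = {}"
    proof (intro ballI impI)
      fix i j assume ij: "i \<in> X" "j \<in> X" "i \<noteq> j"
      have False if e: "e \<in> h" "i \<in> e" "j \<in> e" "e \<inter> Y \<noteq> {}" for e
        using card_two_eq[of e i j] assms(2)[OF e(1)] e ij assms(4) by auto
      then show "{e \<in> h. i \<in> e \<and> e \<inter> Y \<noteq> {}} \<inter> {e \<in> h. j \<in> e \<and> e \<inter> Y \<noteq> {}} = {}"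
        by blast
    qed
  qed (use assms in auto)
  ultimately show ?thesis by simp
qed

section \<open>A choice of least deficiency\<close>

text \<open>
  A pair \<open>(h, a)\<close> of least total deficiency. Subtraction of natural numbers is truncated, so
  \<open>a v - deg h v\<close> is the deficiency of \<open>v\<close>; it is zero also for full vertices. The bounds in \<open>raise\<close>
  and \<open>lower\<close> are the ones at which the final count of edges still closes: up to
  rounding, they say that a vertex moving up from \<open>x\<close> to \<open>y\<close> takes at most as many edges as it has
  in \<open>h\<close>, and one moving down gives up at most as many edges as it has outside \<open>h\<close>.
\<close>

locale critical_choice =
  fixes V :: "'a set" and E h :: "'a set set"
    and C :: "'a \<Rightarrow> nat set" and a :: "'a \<Rightarrow> nat"
  assumes finite_V: "finite V"
    and edge: "e \<in> E \<Longrightarrow> e \<subseteq> V \<and> card e = 2"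
    and raise: "\<lbrakk>v \<in> V; x \<in> C v; 2 * x + 2 < deg E v\<rbrakk> \<Longrightarrow> \<exists>y\<in>C v. x < y \<and> y \<le> 2 * x + 3"
    and lower: "\<lbrakk>v \<in> V; x \<in> C v; deg E v < 2 * x\<rbrakk>
      \<Longrightarrow> \<exists>y\<in>C v. y < x \<and> 2 * x \<le> deg E v + y + 2"
    and h_sub: "h \<subseteq> E"
    and a_choice: "v \<in> V \<Longrightarrow> a v \<in> C v"
    and h_le: "v \<in> V \<Longrightarrow> deg h v \<le> a v + 1"
    and minimal: "\<lbrakk>k \<subseteq> E; \<And>v. v \<in> V \<Longrightarrow> b v \<in> C v; \<And>v. v \<in> V \<Longrightarrow> deg k v \<le> b v + 1\<rbrakk>
      \<Longrightarrow> (\<Sum>v\<in>V. a v - deg h v) \<le> (\<Sum>v\<in>V. b v - deg k v)"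
begin

definition full :: "'a \<Rightarrow> bool" where
  "full v \<longleftrightarrow> deg h v = a v + 1"

definition deficient :: "'a set" where
  "deficient = {v \<in> V. deg h v < a v}"

text \<open>
  The type of a vertex fixes the kind of edge that leaves it: edges of \<open>h\<close> leave full vertices and
  edges outside \<open>h\<close> leave the others. Each step changes the type, so walks along \<open>alt_step\<close> alternate
  by themselves and no pairs of vertex and parity are needed.
\<close>

definition alt_step :: "('a \<times> 'a) set" where
  "alt_step = {(u, v). {u, v} \<in> E \<and>
     (if {u, v} \<in> h then full u \<and> \<not> full v else \<not> full u \<and> full v)}"

definition reached :: "'a set" where
  "reached = alt_step\<^sup>* `` deficient"

definition A :: "'a set" where "A = {v \<in> reached. full v}"
definition B :: "'a set" where "B = {v \<in> reached. \<not> full v}"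

lemma finite_E: "finite E"
  using finite_V edge by (auto intro: finite_subset[of E "Pow V"])

lemma finite_h: "finite h"
  using finite_E h_sub finite_subset by blast

lemma not_full_le: "v \<in> V \<Longrightarrow> \<not> full v \<Longrightarrow> deg h v \<le> a v"
  using h_le[of v] by (auto simp: full_def)

lemma deficient_not_full: "v \<in> deficient \<Longrightarrow> \<not> full v"
  by (auto simp: deficient_def full_def)

lemma deg_le_E: "deg h v \<le> deg E v"
  unfolding deg_def using h_sub finite_E by (intro card_mono) auto

lemma reached_V: "v \<in> reached \<Longrightarrow> v \<in> V"
proof -
  assume "v \<in> reached"
  then obtain s where s: "s \<in> deficient" "(s, v) \<in> alt_step\<^sup>*" by (auto simp: reached_def)
  from s(2,1) show "v \<in> V"
    by (induction rule: rtrancl_induct) (use edge in \<open>auto simp: deficient_def alt_step_def\<close>)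
qed

lemma reached_step: "u \<in> reached \<Longrightarrow> (u, v) \<in> alt_step \<Longrightarrow> v \<in> reached"
  by (auto simp: reached_def intro: rtrancl_into_rtrancl)

text \<open>
  The form in which minimality is used: every exchange below leaves no vertex more deficient and makes
  the vertex from which its path starts less deficient.
\<close>

lemma no_improvement:
  assumes "k \<subseteq> E" "\<And>v. v \<in> V \<Longrightarrow> b v \<in> C v" "\<And>v. v \<in> V \<Longrightarrow> deg k v \<le> b v + 1"
    and le: "\<And>v. v \<in> V \<Longrightarrow> b v - deg k v \<le> a v - deg h v"
    and s: "s \<in> V" "b s - deg k s < a s - deg h s"
  shows False
proof -
  have "(\<Sum>v\<in>V. b v - deg k v) < (\<Sum>v\<in>V. a v - deg h v)"
    by (rule sum_strict_mono_ex1) (use finite_V le s in auto)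
  then show False using minimal[OF assms(1-3)] by simp
qed

section \<open>Exchanging edges along alternating paths\<close>

text \<open>
  Exchange the edges of a shortest alternating path from a deficient vertex \<open>s\<close> to \<open>v\<close>. Each inner
  vertex lies on one edge that is added and on one that is removed, so its degree is unchanged; \<open>s\<close>
  gains an edge, and \<open>v\<close> gains or loses one according to its type. For \<open>v = s\<close> both contributions cancel,
  which is the empty path.

  The path is built layer by layer in the distance from the deficient vertices. The exchange for a
  vertex in layer \<open>n\<close> touches only layers up to \<open>n\<close>, so at a vertex of the next layer the new edge is
  the only one exchanged; this is the edge \<open>e0\<close>.
\<close>

lemma reroute_layer:
  assumes "v \<in> (alt_step ^^ n) `` deficient" "\<And>m. m < n \<Longrightarrow> v \<notin> (alt_step ^^ m) `` deficient"
  shows "\<exists>k s e0. k \<subseteq> E \<and> s \<in> deficient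
    \<and> (\<forall>u. deg k u + of_bool (u = v \<and> \<not> full v) = deg h u + of_bool (u = s) + of_bool (u = v \<and> full v))
    \<and> (\<forall>e. (e \<in> k) \<noteq> (e \<in> h) \<longrightarrow> e \<subseteq> (\<Union>m\<le>n. (alt_step ^^ m) `` deficient)
          \<and> (\<exists>x\<in>e. full x) \<and> (\<exists>x\<in>e. \<not> full x) \<and> (v \<in> e \<longrightarrow> e = e0))"
  using assms
proof (induction n arbitrary: v)
  case 0
  then have "v \<in> deficient" by auto
  then show ?case using h_sub deficient_not_full
    by (intro exI[of _ h] exI[of _ v] exI[of _ "{}"]) auto
next
  case (Suc n)
  then obtain u where u: "u \<in> (alt_step ^^ n) `` deficient" "(u, v) \<in> alt_step" by auto
  have "u \<notin> (alt_step ^^ m) `` deficient" if "m < n" for m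
  proof
    assume "u \<in> (alt_step ^^ m) `` deficient"
    then have "v \<in> (alt_step ^^ Suc m) `` deficient" using u(2) by auto
    then show False using Suc.prems(2)[of "Suc m"] that by simp
  qed
  then obtain k s e0 where k: "k \<subseteq> E" "s \<in> deficient"
    and degk: "\<And>w. deg k w + of_bool (w = u \<and> \<not> full u)
        = deg h w + of_bool (w = s) + of_bool (w = u \<and> full u)"
    and diff: "\<And>e. (e \<in> k) \<noteq> (e \<in> h) \<Longrightarrow> e \<subseteq> (\<Union>m\<le>n. (alt_step ^^ m) `` deficient)
          \<and> (\<exists>x\<in>e. full x) \<and> (\<exists>x\<in>e. \<not> full x) \<and> (u \<in> e \<longrightarrow> e = e0)"
    using Suc.IH[OF u(1)] by blast
  let ?e = "{u, v}"
  have v_new: "v \<notin> (\<Union>m\<le>n. (alt_step ^^ m) `` deficient)"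
    using Suc.prems(2) by (auto simp: less_Suc_eq_le)
  have kh: "?e \<in> k \<longleftrightarrow> ?e \<in> h" using diff[of ?e] v_new by auto
  have uv: "u \<noteq> v" "?e \<in> E" using u(2) edge[of ?e] by (auto simp: alt_step_def)
  have layers: "?e \<subseteq> (\<Union>m\<le>Suc n. (alt_step ^^ m) `` deficient)"
    using u(1) Suc.prems(1) by (auto simp del: relpow.simps)
  have old: "v \<notin> e" if "(e \<in> k) \<noteq> (e \<in> h)" for e using diff[OF that] v_new by blast
  have finite_k: "finite k" using k(1) finite_E finite_subset by blast
  show ?case
  proof (cases "?e \<in> h")
    case True
    have full: "full u" "\<not> full v" using u(2) True by (auto simp: alt_step_def)
    have d: "deg (k - {?e}) w + of_bool (w \<in> ?e) = deg k w" for w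
      using deg_Diff_add[OF finite_k, of "{?e}" w] True kh by (simp add: deg_singleton)
    show ?thesis
    proof (intro exI conjI allI impI)
      show "k - {?e} \<subseteq> E" using k by blast
      show "s \<in> deficient" by (rule k)
      show "deg (k - {?e}) w + of_bool (w = v \<and> \<not> full v)
          = deg h w + of_bool (w = s) + of_bool (w = v \<and> full v)" for w
        using d[of w] degk[of w] uv full by (auto split: if_splits)
    next
      fix e assume "(e \<in> k - {?e}) \<noteq> (e \<in> h)"
      then consider "e = ?e" | "(e \<in> k) \<noteq> (e \<in> h)" by blast
      then have "e \<subseteq> (\<Union>m\<le>Suc n. (alt_step ^^ m) `` deficient)
          \<and> (\<exists>x\<in>e. full x) \<and> (\<exists>x\<in>e. \<not> full x) \<and> (v \<in> e \<longrightarrow> e = ?e)"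
      proof cases
        case 1 then show ?thesis using layers full by blast
      next
        case 2 then show ?thesis using diff[OF 2] old[OF 2] by (auto simp del: relpow.simps simp: atMost_Suc)
      qed
      then show "e \<subseteq> (\<Union>m\<le>Suc n. (alt_step ^^ m) `` deficient)" "\<exists>x\<in>e. full x"
        "\<exists>x\<in>e. \<not> full x" "v \<in> e \<Longrightarrow> e = ?e" by blast+
    qed
  next
    case False
    have full: "\<not> full u" "full v" using u(2) False by (auto simp: alt_step_def)
    have d: "deg (k \<union> {?e}) w = deg k w + of_bool (w \<in> ?e)" for w
      using deg_Un_disjoint[OF finite_k, of "{?e}" w] False kh by (simp add: deg_singleton)
    show ?thesis
    proof (intro exI conjI allI impI)
      show "k \<union> {?e} \<subseteq> E" using k uv by blast
      show "s \<in> deficient" by (rule k)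
      show "deg (k \<union> {?e}) w + of_bool (w = v \<and> \<not> full v)
          = deg h w + of_bool (w = s) + of_bool (w = v \<and> full v)" for w
        using d[of w] degk[of w] uv full by (auto split: if_splits)
    next
      fix e assume "(e \<in> k \<union> {?e}) \<noteq> (e \<in> h)"
      then consider "e = ?e" | "(e \<in> k) \<noteq> (e \<in> h)" by blast
      then have "e \<subseteq> (\<Union>m\<le>Suc n. (alt_step ^^ m) `` deficient)
          \<and> (\<exists>x\<in>e. full x) \<and> (\<exists>x\<in>e. \<not> full x) \<and> (v \<in> e \<longrightarrow> e = ?e)"
      proof cases
        case 1 then show ?thesis using layers full by blast
      next
        case 2 then show ?thesis using diff[OF 2] old[OF 2] by (auto simp del: relpow.simps simp: atMost_Suc)
      qed
      then show "e \<subseteq> (\<Union>m\<le>Suc n. (alt_step ^^ m) `` deficient)" "\<exists>x\<in>e. full x"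
        "\<exists>x\<in>e. \<not> full x" "v \<in> e \<Longrightarrow> e = ?e" by blast+
    qed
  qed
qed

text \<open>
  \<open>k\<close> arises from \<open>h\<close> by exchanging an alternating path from \<open>s\<close> to \<open>v\<close>. Recorded are the effect on the
  degrees, that each exchanged edge joins a full vertex to a non-full one, and that at most the edge
  \<open>e0\<close> is exchanged at \<open>v\<close>. These make it possible to exchange further edges at \<open>v\<close> afterwards.
\<close>

definition rerouted :: "'a \<Rightarrow> 'a set set \<Rightarrow> 'a \<Rightarrow> 'a set \<Rightarrow> bool" where
  "rerouted v k s e0 \<longleftrightarrow> k \<subseteq> E \<and> s \<in> deficient
    \<and> (\<forall>u. deg k u + of_bool (u = v \<and> \<not> full v) = deg h u + of_bool (u = s) + of_bool (u = v \<and> full v))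
    \<and> (\<forall>e. (e \<in> k) \<noteq> (e \<in> h) \<longrightarrow>
          (\<exists>x\<in>e. full x) \<and> (\<exists>x\<in>e. \<not> full x) \<and> (v \<in> e \<longrightarrow> e = e0))"

lemma reroutedD:
  assumes "rerouted v k s e0"
  shows "k \<subseteq> E" "s \<in> deficient"
    "deg k u + of_bool (u = v \<and> \<not> full v) = deg h u + of_bool (u = s) + of_bool (u = v \<and> full v)"
    "(e \<in> k) \<noteq> (e \<in> h) \<Longrightarrow> (\<exists>x\<in>e. full x) \<and> (\<exists>x\<in>e. \<not> full x)"
    "(e \<in> k) \<noteq> (e \<in> h) \<Longrightarrow> v \<in> e \<Longrightarrow> e = e0"
  using assms unfolding rerouted_def by blast+

lemma reroute:
  assumes "v \<in> reached"
  shows "\<exists>k s e0. rerouted v k s e0"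
proof -
  have ex: "\<exists>n. v \<in> (alt_step ^^ n) `` deficient"
    using assms unfolding reached_def rtrancl_is_UN_relpow by auto
  define n where "n = (LEAST n. v \<in> (alt_step ^^ n) `` deficient)"
  have "v \<in> (alt_step ^^ n) `` deficient"
    unfolding n_def by (rule LeastI_ex[OF ex])
  moreover have "v \<notin> (alt_step ^^ m) `` deficient" if "m < n" for m
    using not_less_Least that unfolding n_def by blast
  ultimately show ?thesis using reroute_layer[of v n] unfolding rerouted_def by metis
qed

section \<open>Edges at reached vertices\<close>

text \<open>
  If \<open>y\<close> were not full, the path to \<open>v\<close> could be prolonged by the edge \<open>{v, y}\<close>, which makes up
  for the edge lost at \<open>v\<close> (or, on the empty path, is the edge gained), and \<open>y\<close> has room for it. The path avoids this edge because both its ends are non-full;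
  \<open>y\<close> itself may lie on the path, or be its first vertex \<open>s\<close>, which as a deficient vertex has room for
  two more edges.
\<close>

lemma nonedge_of_B:
  assumes v: "v \<in> B" and e: "{v, y} \<in> E" "{v, y} \<notin> h"
  shows "y \<in> A"
proof -
  have v': "v \<in> reached" "\<not> full v" "v \<in> V" using v reached_V by (auto simp: B_def)
  have y: "y \<in> V" "v \<noteq> y" using edge[OF e(1)] by auto
  have "full y"
  proof (rule ccontr)
    assume nf: "\<not> full y"
    obtain k s e0 where r: "rerouted v k s e0" using reroute[OF v'(1)] by blast
    note k = reroutedD[OF r]
    have "{v, y} \<notin> k" using k(4)[of "{v, y}"] e v' nf by auto
    then have d: "deg (k \<union> {{v, y}}) w = deg k w + of_bool (w \<in> {v, y})" for w
      using deg_Un_disjoint[of k "{{v, y}}" w] finite_subset[OF k(1) finite_E]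
      by (simp add: deg_singleton)
    have dd: "deg (k \<union> {{v, y}}) w = deg h w + of_bool (w = s) + of_bool (w = y)" for w
      using d[of w] k(3)[of w] y v'(2) by (auto split: if_splits)
    have s: "s \<in> V" "deg h s < a s" using k(2) by (auto simp: deficient_def)
    show False
    proof (rule no_improvement[where k = "k \<union> {{v, y}}" and b = a and s = s])
      show "deg (k \<union> {{v, y}}) w \<le> a w + 1" if "w \<in> V" for w
        using h_le[OF that] not_full_le[OF that] nf s unfolding dd by auto
      show "k \<union> {{v, y}} \<subseteq> E" using k e by blast
      show "a w - deg (k \<union> {{v, y}}) w \<le> a w - deg h w" for w
        unfolding dd by linarith
      show "a s - deg (k \<union> {{v, y}}) s < a s - deg h s"
        using dd[of s] s by auto
    qed (use s a_choice in auto)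
  qed
  then show ?thesis using reached_step[OF v'(1), of y] e v' by (auto simp: A_def alt_step_def)
qed

text \<open>
  The mirror image: if \<open>y\<close> were full, the unit that the path adds at \<open>v\<close> could be taken off again by
  removing \<open>{v, y}\<close>, and \<open>y\<close> can spare an edge.
\<close>

lemma edge_of_A:
  assumes v: "v \<in> A" and e: "{v, y} \<in> h"
  shows "y \<in> B"
proof -
  have v': "v \<in> reached" "full v" "v \<in> V" using v reached_V by (auto simp: A_def)
  have eE: "{v, y} \<in> E" using e h_sub by blast
  have y: "y \<in> V" "v \<noteq> y" using edge[OF eE] by auto
  have "\<not> full y"
  proof
    assume fy: "full y"
    obtain k s e0 where r: "rerouted v k s e0" using reroute[OF v'(1)] by blast
    note k = reroutedD[OF r]
    have "{v, y} \<in> k" using k(4)[of "{v, y}"] e v' fy by auto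
    then have d: "deg (k - {{v, y}}) w + of_bool (w \<in> {v, y}) = deg k w" for w
      using deg_Diff_add[of k "{{v, y}}" w] finite_subset[OF k(1) finite_E]
      by (simp add: deg_singleton)
    have dd: "deg (k - {{v, y}}) w + of_bool (w = y) = deg h w + of_bool (w = s)" for w
      using d[of w] k(3)[of w] y v'(2) by (auto split: if_splits)
    have s: "s \<in> V" "deg h s < a s" using k(2) by (auto simp: deficient_def)
    have sy: "s \<noteq> y" using fy deficient_not_full k(2) by blast
    have dy: "deg h y = a y + 1" using fy by (simp add: full_def)
    show False
    proof (rule no_improvement[where k = "k - {{v, y}}" and b = a and s = s])
      show "deg (k - {{v, y}}) w \<le> a w + 1" if "w \<in> V" for w
        using h_le[OF that] dd[of w] s by (cases "w = s") auto
      show "a w - deg (k - {{v, y}}) w \<le> a w - deg h w" if "w \<in> V" for w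
        using dd[of w] dy by (cases "w = y") auto
      show "a s - deg (k - {{v, y}}) s < a s - deg h s"
        using dd[of s] s sy by auto
    qed (use k e s a_choice in auto)
  qed
  then show ?thesis using reached_step[OF v'(1), of y] e eE v' by (auto simp: B_def alt_step_def)
qed

text \<open>
  If \<open>a v\<close> is at most half the degree of \<open>v\<close>, then \<open>h\<close> contains at most half of the edges at \<open>v\<close>.
  Otherwise \<open>v\<close> could switch to a smaller value \<open>b\<close> by losing enough edges to \<open>A\<close>, because every vertex
  of \<open>A\<close> can lose one edge without becoming deficient. By minimality there are not enough such edges
  to bring the degree of \<open>v\<close> down to \<open>b + 1\<close> or below. Deficient vertices gain by the switch alone; for the
  others a path to \<open>v\<close> is exchanged first. The strict inequality at deficient vertices is what
  makes the final count contradictory.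
\<close>

lemma few_edges_to_A:
  assumes v: "v \<in> B"
  shows "card {e \<in> h. v \<in> e \<and> e \<inter> A \<noteq> {}} + deg h v + of_bool (v \<in> deficient) \<le> deg E v"
    (is "card ?X + _ + _ \<le> _")
proof -
  have v': "v \<in> reached" "\<not> full v" "v \<in> V" using v reached_V by (auto simp: B_def)
  have finX: "finite ?X" using finite_h by simp
  have Xle: "card ?X \<le> deg h v" unfolding deg_def using finite_h by (intro card_mono) auto
  have hv: "deg h v \<le> a v" using not_full_le v' by blast
  have vdef: "v \<in> deficient \<longleftrightarrow> deg h v < a v" using v' by (simp add: deficient_def)
  show ?thesis
  proof (cases "2 * a v \<le> deg E v")
    case True
    then show ?thesis using Xle hv vdef by auto
  next
    case False
    then obtain b where b: "b \<in> C v" "b < a v" "2 * a v \<le> deg E v + b + 2"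
      using lower[OF v'(3) a_choice[OF v'(3)]] by auto
    have centre: "v \<in> e \<and> card e = 2" if "e \<in> T" "T \<subseteq> ?X" for e T
      using that edge h_sub by blast
    have leaf: "full u" if "T \<subseteq> ?X" "{u, v} \<in> T" "u \<noteq> v" for u T
      using that v' by (auto simp: A_def)
    show ?thesis
    proof (cases "v \<in> deficient")
      case True
      have "card ?X < deg h v - (b + 1)"
      proof (rule ccontr)
        assume "\<not> card ?X < deg h v - (b + 1)"
        then obtain T where T: "T \<subseteq> ?X" "card T = deg h v - (b + 1)"
          using obtain_subset_with_card_n[of "deg h v - (b + 1)" ?X] by auto
        have d: "deg (h - T) w + deg T w = deg h w" for w
          using deg_Diff_add[of h T w] finite_h T by auto
        have Tv: "deg T v = deg h v - (b + 1)"
          using deg_star_centre[of T v] centre T by auto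
        have Tu: "deg T u = 0 \<or> deg T u = 1 \<and> deg h u = a u + 1" if "u \<noteq> v" for u
          using deg_star_leaf[of T v u] centre T leaf[of T u] that by (auto simp: full_def)
        show False
        proof (rule no_improvement[where k = "h - T" and b = "a(v := b)" and s = v])
          show "deg (h - T) w \<le> (a(v := b)) w + 1" if "w \<in> V" for w
            using d[of w] h_le[OF that] Tv by auto
          show "(a(v := b)) w - deg (h - T) w \<le> a w - deg h w" if "w \<in> V" for w
            using d[of w] Tv Tu[of w] b by (cases "w = v") auto
          show "(a(v := b)) v - deg (h - T) v < a v - deg h v"
            using d[of v] Tv b vdef True by auto
        qed (use h_sub a_choice b v' in auto)
      qed
      then show ?thesis using b vdef True by auto
    next
      case nd: False
      have hv: "deg h v = a v" using nd hv vdef by auto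
      \<comment> \<open>The path already takes one edge from \<open>v\<close>, so \<open>a v - (b + 2)\<close> further ones lead to \<open>b + 1\<close>; if
        \<open>a v = b + 1\<close> the difference is truncated, nothing more is removed and the degree is \<open>b\<close>.\<close>
      have "card ?X \<le> a v - (b + 2)"
      proof (rule ccontr)
        assume big: "\<not> card ?X \<le> a v - (b + 2)"
        obtain k s e0 where r: "rerouted v k s e0" using reroute[OF v'(1)] by blast
        note k = reroutedD[OF r]
        have le: "a v - (b + 2) \<le> card (?X - {e0})"
          using big card_Diff1_le[of ?X e0] card_Diff_singleton_if[of ?X e0] by auto
        obtain T where T: "T \<subseteq> ?X - {e0}" "card T = a v - (b + 2)"
          using obtain_subset_with_card_n[OF le] by blast
        have TX: "T \<subseteq> ?X" using T by blast
        have Tk: "T \<subseteq> k" using T k(5) by blast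
        have d: "deg (k - T) w + deg T w = deg k w" for w
          using deg_Diff_add[of k T w] finite_subset[OF k(1) finite_E] Tk by auto
        have Tv: "deg T v = a v - (b + 2)"
          using deg_star_centre[of T v] centre TX T by auto
        have Tu: "deg T u = 0 \<or> deg T u = 1 \<and> deg h u = a u + 1" if "u \<noteq> v" for u
          using deg_star_leaf[of T v u] centre TX leaf[of T u] that by (auto simp: full_def)
        have s: "s \<in> V" "deg h s < a s" "s \<noteq> v" using k(2) nd by (auto simp: deficient_def)
        have ks: "deg k w = deg h w + of_bool (w = s)" if "w \<noteq> v" for w
          using k(3)[of w] that by auto
        have kv: "deg k v + 1 = a v" using k(3)[of v] hv v' s by auto
        show False
        proof (rule no_improvement[where k = "k - T" and b = "a(v := b)" and s = s])
          show "deg (k - T) w \<le> (a(v := b)) w + 1" if "w \<in> V" for w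
            using d[of w] h_le[OF that] Tv kv ks[of w] s by (cases "w = v"; cases "w = s") auto
          show "(a(v := b)) w - deg (k - T) w \<le> a w - deg h w" if "w \<in> V" for w
            using d[of w] Tv kv ks[of w] Tu[of w] b by (cases "w = v") auto
          show "(a(v := b)) s - deg (k - T) s < a s - deg h s"
            using d[of s] Tu[of s] ks[of s] s by auto
        qed (use k s a_choice b v' in auto)
      qed
      then show ?thesis using b hv nd deg_le_E[of v] by auto
    qed
  qed
qed

text \<open>
  If \<open>a v\<close> is small, \<open>v\<close> could switch to a larger value \<open>b\<close> by taking additional edges to \<open>B\<close>, all of
  whose vertices have room for one more, so minimality leaves few of them. An exchanged path to \<open>v\<close>
  supplies one edge and lowers the deficiency at its first vertex \<open>s\<close>. If \<open>s\<close> itself receives an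
  edge from \<open>v\<close> as well, it ends with degree at most \<open>a s + 1\<close>.
\<close>

lemma few_nonedges_to_B:
  assumes v: "v \<in> A"
  shows "card {e \<in> E - h. v \<in> e \<and> e \<inter> B \<noteq> {}} \<le> deg h v"
    (is "card ?X \<le> _")
proof -
  have v': "v \<in> reached" "full v" "v \<in> V" using v reached_V by (auto simp: A_def)
  have hv: "deg h v = a v + 1" using v' by (simp add: full_def)
  show ?thesis
  proof (cases "deg E v \<le> 2 * a v + 2")
    case True
    have "card ?X \<le> deg (E - h) v"
      unfolding deg_def using finite_E by (intro card_mono) auto
    then show ?thesis using deg_Diff_add[OF finite_E h_sub, of v] True hv by simp
  next
    case False
    then obtain b where b: "b \<in> C v" "a v < b" "b \<le> 2 * a v + 3"
      using raise[OF v'(3) a_choice[OF v'(3)]] by auto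
    \<comment> \<open>With the path the degree is \<open>a v + 2\<close>, and \<open>b - (a v + 2)\<close> more edges lead to \<open>b\<close>; if \<open>b = a v + 1\<close>
      the difference is truncated and \<open>a v + 2 = b + 1\<close> is admissible already.\<close>
    have "card ?X \<le> b - (a v + 2)"
    proof (rule ccontr)
      assume big: "\<not> card ?X \<le> b - (a v + 2)"
      obtain k s e0 where r: "rerouted v k s e0" using reroute[OF v'(1)] by blast
      note k = reroutedD[OF r]
      have le: "b - (a v + 2) \<le> card (?X - {e0})"
        using big card_Diff1_le[of ?X e0] card_Diff_singleton_if[of ?X e0] by auto
      obtain T where T: "T \<subseteq> ?X - {e0}" "card T = b - (a v + 2)"
        using obtain_subset_with_card_n[OF le] by blast
      have Tk: "k \<inter> T = {}" using T k(5) by blast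
      have centre: "v \<in> e \<and> card e = 2" if "e \<in> T" for e
        using that T edge by blast
      have finT: "finite T" using T finite_E finite_subset[of T E] by blast
      have d: "deg (k \<union> T) w = deg k w + deg T w" for w
        using deg_Un_disjoint[of k T w] finite_subset[OF k(1) finite_E] Tk finT by auto
      have Tv: "deg T v = b - (a v + 2)"
        using deg_star_centre[of T v] centre T by auto
      have Tu: "deg T u = 0 \<or> deg T u = 1 \<and> deg h u \<le> a u" if "u \<in> V" "u \<noteq> v" for u
      proof (cases "{u, v} \<in> T")
        case True
        then have "{u, v} \<inter> B \<noteq> {}" using T by blast
        then have "\<not> full u" using v' by (auto simp: B_def)
        then show ?thesis using not_full_le that deg_star_leaf[of T v u] centre True by auto
      next
        case False
        then show ?thesis using that deg_star_leaf[of T v u] centre by auto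
      qed
      have sv: "s \<noteq> v" using k(2) deficient_not_full v' by blast
      have s: "s \<in> V" "deg h s < a s" using k(2) by (auto simp: deficient_def)
      have ks: "deg k w = deg h w + of_bool (w = s)" if "w \<noteq> v" for w
        using k(3)[of w] that by auto
      have kv: "deg k v = a v + 2" using k(3)[of v] hv v' sv by auto
      show False
      proof (rule no_improvement[where k = "k \<union> T" and b = "a(v := b)" and s = s])
        show "k \<union> T \<subseteq> E" using k T by blast
        show "deg (k \<union> T) w \<le> (a(v := b)) w + 1" if "w \<in> V" for w
          using d[of w] h_le[OF that] Tv kv ks[of w] Tu[OF that] s b by (cases "w = v") auto
        show "(a(v := b)) w - deg (k \<union> T) w \<le> a w - deg h w" if "w \<in> V" for w
          using d[of w] Tv kv ks[of w] b by (cases "w = v") auto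
        show "(a(v := b)) s - deg (k \<union> T) s < a s - deg h s"
          using d[of s] ks[of s] s sv by auto
      qed (use s a_choice b v' in auto)
    qed
    then show ?thesis using b hv by auto
  qed
qed

section \<open>Existence of the subgraph\<close>

text \<open>
  The sum of the \<open>h\<close>-degrees over \<open>A\<close> counts the edges of \<open>h\<close> between \<open>A\<close> and \<open>B\<close>. Seen from \<open>B\<close> these
  are fewer than the edges outside \<open>h\<close> at \<open>B\<close>, all of which go to \<open>A\<close>; and seen from \<open>A\<close> the latter
  number at most the sum of the \<open>h\<close>-degrees again.
\<close>

lemma no_deficient: "deficient = {}"
proof (rule ccontr)
  assume "deficient \<noteq> {}"
  then obtain s where s: "s \<in> deficient" by blast
  then have sB: "s \<in> B" using deficient_not_full by (auto simp: B_def reached_def)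
  have fin: "finite A" "finite B"
    using finite_V reached_V by (auto simp: A_def B_def intro: finite_subset)
  have disj: "A \<inter> B = {}" by (auto simp: A_def B_def)
  have out: "{e \<in> h. v \<in> e \<and> e \<inter> B \<noteq> {}} = {e \<in> h. v \<in> e}" if "v \<in> A" for v
  proof -
    have "e \<inter> B \<noteq> {}" if e: "e \<in> h" "v \<in> e" for e
    proof -
      obtain y where "e = {v, y}" using e edge h_sub by (auto simp: card_2_iff)
      then show ?thesis using edge_of_A[OF \<open>v \<in> A\<close>, of y] e by auto
    qed
    then show ?thesis by auto
  qed
  have inn: "{e \<in> E - h. v \<in> e \<and> e \<inter> A \<noteq> {}} = {e \<in> E - h. v \<in> e}" if "v \<in> B" for v
  proof -
    have "e \<inter> A \<noteq> {}" if e: "e \<in> E - h" "v \<in> e" for e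
    proof -
      obtain y where "e = {v, y}" using e edge by (auto simp: card_2_iff)
      then show ?thesis using nonedge_of_B[OF \<open>v \<in> B\<close>, of y] e by auto
    qed
    then show ?thesis by auto
  qed
  have count: "(\<Sum>v\<in>A. card {e \<in> k. v \<in> e \<and> e \<inter> B \<noteq> {}}) = (\<Sum>v\<in>B. card {e \<in> k. v \<in> e \<and> e \<inter> A \<noteq> {}})"
    if "k \<subseteq> E" for k
  proof -
    have k: "finite k" "\<And>e. e \<in> k \<Longrightarrow> card e = 2"
      using that finite_E finite_subset edge by blast+
    have "{e \<in> k. e \<inter> A \<noteq> {} \<and> e \<inter> B \<noteq> {}} = {e \<in> k. e \<inter> B \<noteq> {} \<and> e \<inter> A \<noteq> {}}" by auto
    then show ?thesis
      using sum_card_edges_across[OF k fin(1) disj] sum_card_edges_across[OF k fin(2), of A] disj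
      by (simp add: Int_commute)
  qed
  have "(\<Sum>v\<in>A. deg h v) = (\<Sum>v\<in>A. card {e \<in> h. v \<in> e \<and> e \<inter> B \<noteq> {}})"
    using out by (simp add: deg_def)
  also have "\<dots> = (\<Sum>v\<in>B. card {e \<in> h. v \<in> e \<and> e \<inter> A \<noteq> {}})"
    by (rule count[OF h_sub])
  also have "\<dots> < (\<Sum>v\<in>B. deg (E - h) v)"
  proof (rule sum_strict_mono_ex1[OF fin(2)])
    have "card {e \<in> h. v \<in> e \<and> e \<inter> A \<noteq> {}} + of_bool (v \<in> deficient) \<le> deg (E - h) v"
      if "v \<in> B" for v
      using few_edges_to_A[OF that] deg_Diff_add[OF finite_E h_sub, of v] by simp
    then show "\<forall>v\<in>B. card {e \<in> h. v \<in> e \<and> e \<inter> A \<noteq> {}} \<le> deg (E - h) v"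
      and "\<exists>v\<in>B. card {e \<in> h. v \<in> e \<and> e \<inter> A \<noteq> {}} < deg (E - h) v"
      using s sB by force+
  qed
  also have "\<dots> = (\<Sum>v\<in>B. card {e \<in> E - h. v \<in> e \<and> e \<inter> A \<noteq> {}})"
    by (rule sum.cong[OF refl]) (simp add: deg_def inn del: Diff_iff)
  also have "\<dots> = (\<Sum>v\<in>A. card {e \<in> E - h. v \<in> e \<and> e \<inter> B \<noteq> {}})"
    by (rule count[symmetric]) blast
  also have "\<dots> \<le> (\<Sum>v\<in>A. deg h v)"
    by (rule sum_mono) (rule few_nonedges_to_B)
  finally show False by simp
qed

end

text \<open>
  A pair of least deficiency exists because the empty set of edges, with any choice of values, is
  a candidate. Its deficiency is zero, so all degrees lie between \<open>a v\<close> and \<open>a v + 1\<close>.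
\<close>

theorem paired_degree_subgraph:
  fixes C :: "'a \<Rightarrow> nat set"
  assumes V: "finite V" and E: "\<And>e. e \<in> E \<Longrightarrow> e \<subseteq> V \<and> card e = 2"
    and C: "\<And>v. v \<in> V \<Longrightarrow> C v \<noteq> {}"
    and up: "\<And>v x. \<lbrakk>v \<in> V; x \<in> C v; 2 * x + 2 < deg E v\<rbrakk> \<Longrightarrow> \<exists>y\<in>C v. x < y \<and> y \<le> 2 * x + 3"
    and down: "\<And>v x. \<lbrakk>v \<in> V; x \<in> C v; deg E v < 2 * x\<rbrakk>
      \<Longrightarrow> \<exists>y\<in>C v. y < x \<and> 2 * x \<le> deg E v + y + 2"
  shows "\<exists>h\<subseteq>E. \<forall>v\<in>V. \<exists>x\<in>C v. deg h v = x \<or> deg h v = x + 1"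
proof -
  define ok where "ok = (\<lambda>(k, b). k \<subseteq> E \<and> (\<forall>v\<in>V. b v \<in> C v \<and> deg k v \<le> b v + 1))"
  define f where "f = (\<lambda>(k, b). \<Sum>v\<in>V. b v - deg k v)"
  have "ok ({}, \<lambda>v. SOME x. x \<in> C v)"
    using C by (auto simp: ok_def deg_def some_in_eq)
  then obtain p where p: "ok p" "\<And>q. ok q \<Longrightarrow> f p \<le> f q"
    using ex_has_least_nat[of ok _ f] by blast
  obtain h a where pa: "p = (h, a)" by force
  interpret critical_choice V E h C a
  proof
    show "(\<Sum>v\<in>V. a v - deg h v) \<le> (\<Sum>v\<in>V. b v - deg k v)"
      if "k \<subseteq> E" "\<And>v. v \<in> V \<Longrightarrow> b v \<in> C v" "\<And>v. v \<in> V \<Longrightarrow> deg k v \<le> b v + 1" for k b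
      using p(2)[of "(k, b)"] that unfolding pa ok_def f_def by auto
  qed (use V E up down p(1) in \<open>auto simp: pa ok_def\<close>)
  have "deg h v = a v \<or> deg h v = a v + 1" if "v \<in> V" for v
    using no_deficient h_le[OF that] that by (force simp: deficient_def)
  then show ?thesis using h_sub a_choice by blast
qed

theorem theorem2p6:
  fixes G :: "'a graph"
    and a1 a2 a3 :: "'a \<Rightarrow> int"
    and L :: "'a \<Rightarrow> nat set"
  assumes "finite_simple_graph G"
    and "\<And>v. v \<in> verts G \<Longrightarrow>
           3/10 * real (degree G v) \<le> real_of_int (a1 v) \<and>
           real_of_int (a1 v) \<le> 4/10 * real (degree G v) \<and>
           4/10 * real (degree G v) \<le> real_of_int (a2 v) \<and>
           real_of_int (a2 v) \<le> 6/10 * real (degree G v) \<and>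
           6/10 * real (degree G v) \<le> real_of_int (a3 v) \<and>
           real_of_int (a3 v) \<le> 7/10 * real (degree G v)"
    and "\<And>v. v \<in> verts G \<Longrightarrow>
           int ` L v = {a1 v, a1 v + 1, a2 v, a2 v + 1, a3 v, a3 v + 1}"
  shows "\<exists>H. is_factor L H G"
proof -
  have degree_deg: "degree K v = deg (edges K) v" for K :: "'a graph" and v
    by (simp add: degree_def deg_def)
  define C where "C = (\<lambda>v. {nat (a1 v), nat (a2 v), nat (a3 v)})"
  have nat_bounds: "\<exists>x y z. a1 v = int x \<and> a2 v = int y \<and> a3 v = int z \<and> C v = {x, y, z} \<and>
      3 * deg (edges G) v \<le> 10 * x \<and> 10 * x \<le> 4 * deg (edges G) v \<and>
      4 * deg (edges G) v \<le> 10 * y \<and> 10 * y \<le> 6 * deg (edges G) v \<and>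
      6 * deg (edges G) v \<le> 10 * z \<and> 10 * z \<le> 7 * deg (edges G) v" if "v \<in> verts G" for v
  proof -
    let ?d = "deg (edges G) v"
    have b: "3 * int ?d \<le> 10 * a1 v" "10 * a1 v \<le> 4 * int ?d" "4 * int ?d \<le> 10 * a2 v"
      "10 * a2 v \<le> 6 * int ?d" "6 * int ?d \<le> 10 * a3 v" "10 * a3 v \<le> 7 * int ?d"
      using assms(2)[OF that] unfolding degree_deg by linarith+
    then have "0 \<le> a1 v" "0 \<le> a2 v" "0 \<le> a3 v" by linarith+
    then show ?thesis using b
      by (intro exI[of _ "nat (a1 v)"] exI[of _ "nat (a2 v)"] exI[of _ "nat (a3 v)"])
        (auto simp: C_def)
  qed
  have "\<exists>h\<subseteq>edges G. \<forall>v\<in>verts G. \<exists>x\<in>C v. deg h v = x \<or> deg h v = x + 1"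
  proof (rule paired_degree_subgraph)
    fix v x assume v: "v \<in> verts G" "x \<in> C v"
    obtain p q r where "C v = {p, q, r}"
      and b: "3 * deg (edges G) v \<le> 10 * p" "10 * p \<le> 4 * deg (edges G) v"
      "4 * deg (edges G) v \<le> 10 * q" "10 * q \<le> 6 * deg (edges G) v"
      "6 * deg (edges G) v \<le> 10 * r" "10 * r \<le> 7 * deg (edges G) v"
      using nat_bounds[OF v(1)] by blast
    then have C: "C v = {p, q, r}" "x = p \<or> x = q \<or> x = r" using v by auto
    \<comment> \<open>Going up from \<open>p\<close> or \<open>q\<close>: the target is \<open>q \<le> 2 * p\<close> (since \<open>6/10\<close> is twice \<open>3/10\<close>) or
      \<open>r\<close>, which is at most twice \<open>4/10\<close> of the degree. The value \<open>r\<close> is used for \<open>p\<close> when \<open>p = q\<close>;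
      then both equal \<open>4/10\<close> of the degree.\<close>
    show "\<exists>y\<in>C v. x < y \<and> y \<le> 2 * x + 3" if "2 * x + 2 < deg (edges G) v"
    proof -
      have "x < q \<and> q \<le> 2 * x + 3 \<or> x < r \<and> r \<le> 2 * x + 3"
        using C(2) b that by linarith
      then show ?thesis using C by auto
    qed
    \<comment> \<open>The bounds are symmetric under passing to complements, so going down is the mirror image.\<close>
    show "\<exists>y\<in>C v. y < x \<and> 2 * x \<le> deg (edges G) v + y + 2" if "deg (edges G) v < 2 * x"
    proof -
      have "p < x \<and> 2 * x \<le> deg (edges G) v + p + 2 \<or> q < x \<and> 2 * x \<le> deg (edges G) v + q + 2"
        using C(2) b that by linarith
      then show ?thesis using C by auto
    qed
  qed (use assms(1) in \<open>auto simp: finite_simple_graph_def C_def\<close>)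
  then obtain h where h: "h \<subseteq> edges G"
    "\<And>v. v \<in> verts G \<Longrightarrow> \<exists>x\<in>C v. deg h v = x \<or> deg h v = x + 1" by blast
  have "deg h v \<in> L v" if "v \<in> verts G" for v
  proof -
    have "int (deg h v) \<in> int ` L v"
      using h(2)[OF that] nat_bounds[OF that] unfolding assms(3)[OF that] by auto
    then show ?thesis by auto
  qed
  then have "is_factor L (verts G, h) G"
    using h(1) assms(1)
    by (auto simp: is_factor_def spanning_subgraph_def finite_simple_graph_def degree_deg)
  then show ?thesis by blast
qed

end
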